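(* Let $(T,w)$ be an integer weighted tree, and let $(T',w')$ be a concentration of $(T,w)$. Then $\operatorname{th}_f(T,w)=\operatorname{th}_f(T',w')$.
   Context: All graphs are finite and simple. Full forcing: given a graph $G$ and an initial set $B\subseteq V(G)$ of blue vertices (all others white), in each time step every white vertex having a blue neighbor becomes blue. The full forcing propagation time $\operatorname{pt}_f(G;B)$ is the least number $k\ge 0$ of time steps after which all vertices of $G$ are blue ($\infty$ if this never happens). A weighted tree $(T,w)$ is a tree $T$ with a weight function $w:V(T)\to\mathbb{R}^+$ (positive reals); it is integer weighted if $w$ takes (positive) integer values. For $B\subseteq V(T)$ put $w(B)=\sum_{x\in B}w(x)$, $\operatorname{th}_f(T,w;B)=w(B)+\operatorname{pt}_f(T;B)$, and $\operatorname{th}_f(T,w)=\min_{B\subseteq V(T)}\operatorname{th}_f(T,w;B)$ (the weights do not affect the propagation). For $v\in V(T)$, the components of $T-v$ are the branches of $T$ at $v$. Branches $T_1,T_2$ of $T$ at $v$ are weight isomorphic if there is an automorphism $\sigma$ of $T$ such that (1) $\sigma(x)=x$ for all $x\in V(T)\setminus(V(T_1)\cup V(T_2))$, $\sigma(V(T_1))=V(T_2)$ and $\sigma(V(T_2))=V(T_1)$; and (2) $w(x)=w(\sigma(x))$ for all $x\in V(T_1)$. Single concentration: let $(T,w)$ be an integer weighted tree, let $v\in V(T)$ with $w(v)=1$, and let $\{T_1,\dots,T_\ell\}$ be a maximal set of pairwise weight isomorphic branches of $T$ at $v$. The single concentration of $T$ at $v$ is the weighted tree $(T',w')$ where $T'$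 is obtained from $T$ by deleting the branches $T_2,\dots,T_\ell$, and $w'(x)=\ell\, w(x)$ if $x\in V(T_1)$, $w'(x)=w(x)$ otherwise. A concentration of $(T,w)$ is any weighted tree obtained by one or more iterations of this process. *)

theory Defs
  imports
    "Graph_Theory.Graph_Theory"
    "HOL-Library.Extended_Real"
begin

text \<open>
  Finite simple graphs are represented by the library locale \<open>graph\<close>: finite, symmetric digraphs
  without loops or parallel arcs.  An edge \<open>{u, v}\<close> is a pair of opposite arcs, so the closed walk
  \<open>u, v, u\<close> counts as a library \<open>cycle\<close> (of length 2), and the library constant \<open>tree\<close> would
  exclude every graph with an edge.  The cycles of the underlying simple graph are exactly the
  cycles of length at least 3.
\<close>

definition simple_tree :: "('a, 'b) pre_digraph \<Rightarrow> bool" where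
  "simple_tree G \<longleftrightarrow> graph G \<and> Digraph_Component.connected G \<and>
     \<not> (\<exists>p. pre_digraph.cycle G p \<and> 3 \<le> length p)"


section \<open>Full forcing\<close>

definition full_force_step :: "('a, 'b) pre_digraph \<Rightarrow> 'a set \<Rightarrow> 'a set" where
  "full_force_step G S = S \<union> {y \<in> verts G. \<exists>x\<in>S. x \<rightarrow>\<^bsub>G\<^esub> y}"

definition blue_after :: "('a, 'b) pre_digraph \<Rightarrow> 'a set \<Rightarrow> nat \<Rightarrow> 'a set" where
  "blue_after G B k = (full_force_step G ^^ k) B"

text \<open>The infimum of the empty set in \<open>enat\<close> is \<open>\<infinity>\<close>.\<close>

definition pt_f :: "('a, 'b) pre_digraph \<Rightarrow> 'a set \<Rightarrow> enat" where
  "pt_f G B = (INF k\<in>{k. blue_after G B k = verts G}. enat k)"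


section \<open>Weighted trees and throttling\<close>

text \<open>A weight function is a total function of which only the values on the vertices matter.\<close>

definition weighted_tree :: "('a, 'b) pre_digraph \<Rightarrow> ('a \<Rightarrow> real) \<Rightarrow> bool" where
  "weighted_tree T w \<longleftrightarrow> simple_tree T \<and> (\<forall>x\<in>verts T. 0 < w x)"

definition integer_weighted_tree :: "('a, 'b) pre_digraph \<Rightarrow> ('a \<Rightarrow> real) \<Rightarrow> bool" where
  "integer_weighted_tree T w \<longleftrightarrow> weighted_tree T w \<and> (\<forall>x\<in>verts T. w x \<in> \<int>)"

definition th_f_set :: "('a, 'b) pre_digraph \<Rightarrow> ('a \<Rightarrow> real) \<Rightarrow> 'a set \<Rightarrow> ereal" where
  "th_f_set T w B = ereal (\<Sum>x\<in>B. w x) + ereal_of_enat (pt_f T B)"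

definition th_f :: "('a, 'b) pre_digraph \<Rightarrow> ('a \<Rightarrow> real) \<Rightarrow> ereal" where
  "th_f T w = Min (th_f_set T w ` Pow (verts T))"


section \<open>Branches and concentrations\<close>

text \<open>In a symmetric digraph, strongly connected components and components coincide.\<close>

definition branches :: "('a, 'b) pre_digraph \<Rightarrow> 'a \<Rightarrow> ('a, 'b) pre_digraph set" where
  "branches T v = pre_digraph.sccs (pre_digraph.del_vert T v)"

definition graph_automorphism :: "('a, 'b) pre_digraph \<Rightarrow> ('a \<Rightarrow> 'a) \<Rightarrow> bool" where
  "graph_automorphism G \<sigma> \<longleftrightarrow> bij_betw \<sigma> (verts G) (verts G) \<and>
     (\<forall>x\<in>verts G. \<forall>y\<in>verts G. x \<rightarrow>\<^bsub>G\<^esub> y \<longleftrightarrow> \<sigma> x \<rightarrow>\<^bsub>G\<^esub> \<sigma> y)"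

definition weight_isomorphic ::
    "('a, 'b) pre_digraph \<Rightarrow> ('a \<Rightarrow> real) \<Rightarrow> ('a, 'b) pre_digraph \<Rightarrow> ('a, 'b) pre_digraph \<Rightarrow> bool" where
  "weight_isomorphic T w T1 T2 \<longleftrightarrow> (\<exists>\<sigma>. graph_automorphism T \<sigma> \<and>
     (\<forall>x \<in> verts T - (verts T1 \<union> verts T2). \<sigma> x = x) \<and>
     \<sigma> ` verts T1 = verts T2 \<and> \<sigma> ` verts T2 = verts T1 \<and>
     (\<forall>x\<in>verts T1. w x = w (\<sigma> x)))"

definition weight_isomorphic_branches ::
    "('a, 'b) pre_digraph \<Rightarrow> ('a \<Rightarrow> real) \<Rightarrow> 'a \<Rightarrow> ('a, 'b) pre_digraph set \<Rightarrow> bool" where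
  "weight_isomorphic_branches T w v S \<longleftrightarrow>
     S \<subseteq> branches T v \<and> pairwise (weight_isomorphic T w) S"

definition maximal_weight_isomorphic_branches ::
    "('a, 'b) pre_digraph \<Rightarrow> ('a \<Rightarrow> real) \<Rightarrow> 'a \<Rightarrow> ('a, 'b) pre_digraph set \<Rightarrow> bool" where
  "maximal_weight_isomorphic_branches T w v S \<longleftrightarrow> weight_isomorphic_branches T w v S \<and>
     (\<forall>S'. weight_isomorphic_branches T w v S' \<and> S \<subseteq> S' \<longrightarrow> S' = S)"

text \<open>
  Here \<open>S = {T\<^sub>1, \<dots>, T\<^sub>l}\<close> and \<open>T1\<close> is the branch that is kept.  The requirement
  \<open>T1 \<in> S\<close> forces \<open>l \<ge> 1\<close>; the value \<open>l = 1\<close> is allowed and changes nothing.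
\<close>

inductive single_concentration ::
    "('a, 'b) pre_digraph \<times> ('a \<Rightarrow> real) \<Rightarrow> ('a, 'b) pre_digraph \<times> ('a \<Rightarrow> real) \<Rightarrow> bool" where
  "single_concentration (T, w) (T', w')"
  if "integer_weighted_tree T w"
    and "v \<in> verts T" and "w v = 1"
    and "maximal_weight_isomorphic_branches T w v S" and "T1 \<in> S"
    and "T' = T \<restriction> (verts T - (\<Union>H \<in> S - {T1}. verts H))"
    and "\<forall>x\<in>verts T'. w' x = (if x \<in> verts T1 then real (card S) * w x else w x)"

definition concentration ::
    "('a, 'b) pre_digraph \<times> ('a \<Rightarrow> real) \<Rightarrow> ('a, 'b) pre_digraph \<times> ('a \<Rightarrow> real) \<Rightarrow> bool" where
  "concentration = single_concentration\<^sup>+\<^sup>+"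

end

theory Submission
  imports Defs
begin

text \<open>
  It suffices to treat a single concentration at \<open>v\<close>, with branches \<open>T\<^sub>1, \<dots>, T\<^sub>l\<close> of which
  \<open>T\<^sub>1\<close> is kept.  The only paths between different branches, or between a branch and the rest of the
  tree, pass through \<open>v\<close>; so the argument is about isomorphic blocks that hang off a common
  vertex (locale \<open>isomorphic_blocks\<close>).  Two families of maps carry blue sets back and forth.

  From \<open>T'\<close> to \<open>T\<close>: folding all branches onto \<open>T\<^sub>1\<close> lifts every edge of \<open>T'\<close>, so the preimage of a
  blue set \<open>B'\<close> propagates in \<open>T\<close> as fast as \<open>B'\<close> does in \<open>T'\<close>.  It contains \<open>l\<close> copies of
  \<open>B' \<inter> T\<^sub>1\<close>, and the factor \<open>l\<close> in \<open>w'\<close> pays for exactly these.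

  From \<open>T\<close> to \<open>T'\<close>: for a chosen \<open>i\<close>, discard the part of \<open>B\<close> in the branches other than \<open>T\<^sub>i\<close> and
  move \<open>B \<inter> T\<^sub>i\<close> to \<open>T\<^sub>1\<close>.  This is the action of the map that collapses the branches other than
  \<open>T\<^sub>i\<close> to \<open>v\<close> and moves \<open>T\<^sub>i\<close> to \<open>T\<^sub>1\<close>.  It respects adjacency up to equality, so the only thing
  that can be lost is the time at which \<open>v\<close> turns blue.  There are two remedies.
  If the weights \<open>w (B \<inter> T\<^sub>i)\<close> are not all equal, take \<open>i\<close> with the least weight: the total is
  at least \<open>l w (B \<inter> T\<^sub>i) + 1\<close> by integrality, and the saved unit pays for making \<open>v\<close> itself blue,
  because \<open>w v = 1\<close>.  If they are all equal, every \<open>i\<close> gives the same cost, and \<open>i\<close> can be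
  chosen so that \<open>v\<close> is forced as early as before: take a branch from which \<open>v\<close> is first forced,
  if there is one.  If \<open>v \<in> B\<close>, it stays blue and the branch of least weight will do.
\<close>

section \<open>Full forcing along maps of graphs\<close>

lemma blue_after_0 [simp]: "blue_after G B 0 = B"
  by (simp add: blue_after_def)

lemma blue_after_Suc:
  "blue_after G B (Suc k)
     = blue_after G B k \<union> {y \<in> verts G. \<exists>x\<in>blue_after G B k. x \<rightarrow>\<^bsub>G\<^esub> y}"
  by (simp add: blue_after_def full_force_step_def)

lemma blue_after_mono:
  assumes "k \<le> l"
  shows "blue_after G B k \<subseteq> blue_after G B l"
  using assms by (induction l rule: dec_induct) (auto simp: blue_after_Suc)

lemma blue_after_subset_verts:
  assumes "B \<subseteq> verts G"
  shows "blue_after G B k \<subseteq> verts G"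
  using assms by (induction k) (auto simp: blue_after_Suc)

text \<open>
  A blue vertex stays blue, so an edge whose two ends are identified does no harm to the
  propagation: a map that contracts or preserves each edge transports forcing.
\<close>

lemma blue_after_map:
  assumes verts: "\<And>x. x \<in> verts G \<Longrightarrow> f x \<in> verts H"
    and edge: "\<And>x y. x \<rightarrow>\<^bsub>G\<^esub> y \<Longrightarrow> f x = f y \<or> f x \<rightarrow>\<^bsub>H\<^esub> f y"
    and B: "f ` B \<subseteq> B'"
    and x: "x \<in> blue_after G B k"
  shows "f x \<in> blue_after H B' k"
  using x
proof (induction k arbitrary: x)
  case 0
  then show ?case using B by auto
next
  case (Suc k)
  consider "x \<in> blue_after G B k"
    | u where "u \<in> blue_after G B k" "u \<rightarrow>\<^bsub>G\<^esub> x" "x \<in> verts G"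
    using Suc.prems by (auto simp: blue_after_Suc)
  then show ?case
  proof cases
    case 1
    then show ?thesis using Suc.IH by (simp add: blue_after_Suc)
  next
    case 2
    then show ?thesis using Suc.IH[of u] edge[of u x] verts[of x]
      by (auto simp: blue_after_Suc)
  qed
qed

text \<open>
  Here some blue vertices may be mapped to \<open>v\<close> although \<open>v\<close> is not blue in the target.  Such
  vertices are harmless as long as they can only be felt through \<open>v\<close> (the assumption
  \<open>fibre\<close>): everything outside the fibre over \<open>v\<close> is then forced either from outside the fibre or
  by \<open>v\<close> itself.  What has to be ensured is that the image of \<open>v\<close> is not late, and the
  assumption \<open>forcer\<close> provides this by a forcing neighbor that is not collapsed.
\<close>

lemma blue_after_collapse:
  assumes verts: "\<And>x. x \<in> verts G \<Longrightarrow> f x \<in> verts H"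
    and edge: "\<And>x y. x \<rightarrow>\<^bsub>G\<^esub> y \<Longrightarrow> f x = f y \<or> f x \<rightarrow>\<^bsub>H\<^esub> f y"
    and fv: "f v = v"
    and fibre: "\<And>x y. x \<rightarrow>\<^bsub>G\<^esub> y \<Longrightarrow> f x = v \<Longrightarrow> f y \<noteq> v \<Longrightarrow> x = v"
    and B: "\<And>x. x \<in> B \<Longrightarrow> f x \<noteq> v \<Longrightarrow> f x \<in> B'" and v: "v \<notin> B"
    and forcer: "\<And>k. v \<notin> blue_after G B k \<Longrightarrow> v \<in> blue_after G B (Suc k) \<Longrightarrow>
                   \<exists>x\<in>blue_after G B k. x \<rightarrow>\<^bsub>G\<^esub> v \<and> f x \<noteq> v"
    and x: "x \<in> blue_after G B k" "f x \<noteq> v \<or> v \<in> blue_after G B k"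
  shows "f x \<in> blue_after H B' k"
  using x
proof (induction k arbitrary: x)
  case 0
  then show ?case using B v by auto
next
  case (Suc k)
  show ?case
  proof (cases "f x = v")
    case True
    then have v_blue: "v \<in> blue_after G B (Suc k)" using Suc.prems by auto
    show ?thesis
    proof (cases "v \<in> blue_after G B k")
      case True
      then show ?thesis using Suc.IH[of v] fv \<open>f x = v\<close> by (simp add: blue_after_Suc)
    next
      case False
      then obtain u where u: "u \<in> blue_after G B k" "u \<rightarrow>\<^bsub>G\<^esub> v" "f u \<noteq> v"
        using forcer v_blue by blast
      have "v \<in> verts G" using v_blue False by (auto simp: blue_after_Suc)
      then show ?thesis
        using Suc.IH[of u] u edge[OF u(2)] verts[of v] fv \<open>f x = v\<close>
        by (auto simp: blue_after_Suc)
    qed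
  next
    case False
    consider "x \<in> blue_after G B k"
      | u where "u \<in> blue_after G B k" "u \<rightarrow>\<^bsub>G\<^esub> x" "x \<in> verts G"
      using Suc.prems by (auto simp: blue_after_Suc)
    then show ?thesis
    proof cases
      case 1
      then show ?thesis using Suc.IH False by (simp add: blue_after_Suc)
    next
      case 2
      then have "f u \<noteq> v \<or> v \<in> blue_after G B k" using fibre[of u x] False by auto
      then show ?thesis using Suc.IH[of u] 2 edge[of u x] verts[of x]
        by (auto simp: blue_after_Suc)
    qed
  qed
qed

text \<open>
  Dually, under a map along which edges of the target lift, each forcing step of the target lifts
  to every vertex of the fibre over the forced vertex.
\<close>

lemma blue_after_vimage:
  assumes lift: "\<And>y x'. y \<in> verts G \<Longrightarrow> x' \<rightarrow>\<^bsub>H\<^esub> f y \<Longrightarrow> \<exists>x\<in>verts G. x \<rightarrow>\<^bsub>G\<^esub> y \<and> f x = x'"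
    and y: "y \<in> verts G" "f y \<in> blue_after H B' k"
  shows "y \<in> blue_after G {x \<in> verts G. f x \<in> B'} k"
  using y
proof (induction k arbitrary: y)
  case 0
  then show ?case by simp
next
  case (Suc k)
  consider "f y \<in> blue_after H B' k"
    | x' where "x' \<in> blue_after H B' k" "x' \<rightarrow>\<^bsub>H\<^esub> f y"
    using Suc.prems by (auto simp: blue_after_Suc)
  then show ?case
  proof cases
    case 1
    then show ?thesis using Suc by (simp add: blue_after_Suc)
  next
    case 2
    then obtain x where "x \<in> verts G" "x \<rightarrow>\<^bsub>G\<^esub> y" "f x = x'"
      using lift Suc.prems(1) by blast
    then show ?thesis using Suc 2 by (auto simp: blue_after_Suc)
  qed
qed

text \<open>
  The transfer condition quantifies over all times instead of comparing propagation times, so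
  that a set which never forces the whole graph needs no separate treatment.
\<close>

lemma th_f_mono:
  assumes "finite (verts G)" "finite (verts H)"
    and transfer: "\<And>B. B \<subseteq> verts G \<Longrightarrow> \<exists>B'\<subseteq>verts H. sum w' B' \<le> sum w B \<and>
           (\<forall>k. blue_after G B k = verts G \<longrightarrow> blue_after H B' k = verts H)"
  shows "th_f H w' \<le> th_f G w"
proof -
  have "Min (th_f_set H w' ` Pow (verts H)) \<le> th_f_set G w B" if "B \<subseteq> verts G" for B
  proof -
    obtain B' where B': "B' \<subseteq> verts H" "sum w' B' \<le> sum w B"
        "\<And>k. blue_after G B k = verts G \<Longrightarrow> blue_after H B' k = verts H"
      using transfer[OF \<open>B \<subseteq> verts G\<close>] by blast
    have "pt_f H B' \<le> pt_f G B"
      unfolding pt_f_def by (rule INF_superset_mono) (use B'(3) in auto)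
    then have "th_f_set H w' B' \<le> th_f_set G w B"
      unfolding th_f_set_def using B'(2) by (intro add_mono) auto
    moreover have "Min (th_f_set H w' ` Pow (verts H)) \<le> th_f_set H w' B'"
      using B'(1) assms(2) by (intro Min_le) auto
    ultimately show ?thesis by simp
  qed
  then show ?thesis
    unfolding th_f_def using assms(1) by (subst Min_ge_iff) auto
qed

section \<open>Isomorphic blocks attached to a vertex\<close>

text \<open>
  The blocks are indexed by \<open>I\<close>, and \<open>\<tau> i\<close> moves block \<open>i\<close> to the block of the index \<open>r\<close> that is
  kept.  The maps \<open>\<tau> i\<close> are only described on their blocks; they respect the edges to \<open>v\<close> as if
  \<open>v\<close> were fixed.
\<close>

locale isomorphic_blocks =
  fixes T :: "('a, 'b) pre_digraph" and w :: "'a \<Rightarrow> real" and v :: 'a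
    and I :: "'i set" and C :: "'i \<Rightarrow> 'a set" and r :: 'i and \<tau> :: "'i \<Rightarrow> 'a \<Rightarrow> 'a"
    and T' :: "('a, 'b) pre_digraph" and w' :: "'a \<Rightarrow> real"
  assumes graph: "graph T"
    and v: "v \<in> verts T" "w v = 1"
    and w_int: "\<And>x. x \<in> verts T \<Longrightarrow> w x \<in> \<int>"
    and I: "finite I" "r \<in> I"
    and C: "\<And>i. i \<in> I \<Longrightarrow> C i \<subseteq> verts T - {v}"
    and disj: "\<And>i j. i \<in> I \<Longrightarrow> j \<in> I \<Longrightarrow> i \<noteq> j \<Longrightarrow> C i \<inter> C j = {}"
    and closed: "\<And>i x y. i \<in> I \<Longrightarrow> x \<in> C i \<Longrightarrow> x \<rightarrow>\<^bsub>T\<^esub> y \<Longrightarrow> y \<noteq> v \<Longrightarrow> y \<in> C i"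
    and \<tau>_bij: "\<And>i. i \<in> I \<Longrightarrow> bij_betw (\<tau> i) (C i) (C r)"
    and \<tau>_edge: "\<And>i x y. i \<in> I \<Longrightarrow> x \<in> C i \<Longrightarrow> y \<in> C i \<Longrightarrow>
                   \<tau> i x \<rightarrow>\<^bsub>T\<^esub> \<tau> i y \<longleftrightarrow> x \<rightarrow>\<^bsub>T\<^esub> y"
    and \<tau>_root: "\<And>i x. i \<in> I \<Longrightarrow> x \<in> C i \<Longrightarrow> \<tau> i x \<rightarrow>\<^bsub>T\<^esub> v \<longleftrightarrow> x \<rightarrow>\<^bsub>T\<^esub> v"
    and \<tau>_w: "\<And>i x. i \<in> I \<Longrightarrow> x \<in> C i \<Longrightarrow> w (\<tau> i x) = w x"
    and T': "T' = T \<restriction> (verts T - (\<Union>j\<in>I - {r}. C j))"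
    and w': "\<And>x. x \<in> verts T' \<Longrightarrow> w' x = (if x \<in> C r then real (card I) * w x else w x)"
begin

interpretation graph T by (rule graph)

lemma adj_sym: "x \<rightarrow>\<^bsub>T\<^esub> y \<longleftrightarrow> y \<rightarrow>\<^bsub>T\<^esub> x"
  using sym_arcs by (metis symmetric_def symD)

text \<open>This part, which contains \<open>v\<close>, is left alone by all the maps below.\<close>

definition Out :: "'a set" where
  "Out = verts T - (\<Union>i\<in>I. C i)"

lemma v_not_C: "i \<in> I \<Longrightarrow> v \<notin> C i"
  using C by blast

lemma v_Out: "v \<in> Out"
  using v v_not_C by (auto simp: Out_def)

lemma verts_cases:
  assumes "x \<in> verts T"
  obtains "x \<in> Out" | i where "i \<in> I" "x \<in> C i"
  using assms by (auto simp: Out_def)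

lemma C_unique: "i \<in> I \<Longrightarrow> j \<in> I \<Longrightarrow> x \<in> C i \<Longrightarrow> x \<in> C j \<Longrightarrow> i = j"
  using disj by blast

lemma Out_not_C: "x \<in> Out \<Longrightarrow> i \<in> I \<Longrightarrow> x \<notin> C i"
  by (auto simp: Out_def)

lemma verts_T': "verts T' = Out \<union> C r"
  unfolding T' Out_def using I C disj by auto blast+

lemma edge_T': "x \<rightarrow>\<^bsub>T'\<^esub> y \<longleftrightarrow> x \<rightarrow>\<^bsub>T\<^esub> y \<and> x \<in> verts T' \<and> y \<in> verts T'"
  unfolding T' by (auto simp: induce_subgraph_def arcs_ends_def arc_to_ends_def)

lemma \<tau>_in: "i \<in> I \<Longrightarrow> x \<in> C i \<Longrightarrow> \<tau> i x \<in> C r"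
  using \<tau>_bij bij_betwE by blast

lemma finite_C: "i \<in> I \<Longrightarrow> finite (C i)"
  using C finite_verts by (meson finite_Diff finite_subset)

lemma finite_verts_T': "finite (verts T')"
  unfolding verts_T' Out_def using finite_C I by simp

lemma sum_blocks:
  assumes "B \<subseteq> verts T"
  shows "sum w B = sum w (B \<inter> Out) + (\<Sum>i\<in>I. sum w (B \<inter> C i))"
proof -
  have B: "B = (B \<inter> Out) \<union> (\<Union>i\<in>I. B \<inter> C i)"
    using assms by (auto simp: Out_def)
  have fin: "finite B" using assms finite_verts finite_subset by blast
  have "sum w B = sum w (B \<inter> Out) + sum w (\<Union>i\<in>I. B \<inter> C i)"
    by (subst B, rule sum.union_disjoint) (use fin I in \<open>auto simp: Out_def\<close>)
  also have "sum w (\<Union>i\<in>I. B \<inter> C i) = (\<Sum>i\<in>I. sum w (B \<inter> C i))"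
    using I fin disj by (intro sum.UNION_disjoint) auto
  finally show ?thesis .
qed

lemma sum_T':
  assumes "B' \<subseteq> verts T'"
  shows "sum w' B' = sum w (B' \<inter> Out) + real (card I) * sum w (B' \<inter> C r)"
proof -
  have fin: "finite B'" using assms finite_verts_T' finite_subset by blast
  have "sum w' B' = sum w' (B' \<inter> Out) + sum w' (B' \<inter> C r)"
    by (subst sum.union_disjoint[symmetric])
       (use fin assms I Out_not_C in \<open>auto simp: verts_T' Int_Un_distrib[symmetric] Int_absorb2\<close>)
  also have "sum w' (B' \<inter> Out) = sum w (B' \<inter> Out)"
    using Out_not_C I w' by (intro sum.cong) (auto simp: verts_T')
  also have "sum w' (B' \<inter> C r) = real (card I) * sum w (B' \<inter> C r)"
    unfolding sum_distrib_left using w' by (intro sum.cong) (auto simp: verts_T')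
  finally show ?thesis .
qed

subsection \<open>Unfolding\<close>

definition fold_map :: "'a \<Rightarrow> 'a" where
  "fold_map x = (if x \<in> Out then x else \<tau> (THE i. i \<in> I \<and> x \<in> C i) x)"

lemma fold_map_Out [simp]: "x \<in> Out \<Longrightarrow> fold_map x = x"
  by (simp add: fold_map_def)

lemma fold_map_C [simp]:
  assumes "i \<in> I" "x \<in> C i"
  shows "fold_map x = \<tau> i x"
proof -
  have "(THE i. i \<in> I \<and> x \<in> C i) = i" using assms C_unique by blast
  then show ?thesis using assms Out_not_C by (auto simp: fold_map_def)
qed

lemma fold_map_verts: "x \<in> verts T \<Longrightarrow> fold_map x \<in> verts T'"
  by (erule verts_cases) (auto simp: verts_T' \<tau>_in)

text \<open>
  An edge from the kept block leads into that block or to \<open>v\<close>.  So an edge of \<open>T'\<close> at the image of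
  \<open>y\<close> is copied by \<open>\<tau> i\<close> from an edge at \<open>y\<close> if \<open>y\<close> lies in block \<open>i\<close>; if \<open>y\<close> lies in no block, only
  \<open>y = v\<close> can have a neighbor in the kept block, and all edges between blocks and \<open>v\<close> are copies of
  each other.
\<close>

lemma fold_map_lift:
  assumes y: "y \<in> verts T" and edge: "x' \<rightarrow>\<^bsub>T'\<^esub> fold_map y"
  shows "\<exists>x\<in>verts T. x \<rightarrow>\<^bsub>T\<^esub> y \<and> fold_map x = x'"
proof -
  have e: "x' \<rightarrow>\<^bsub>T\<^esub> fold_map y" and x': "x' \<in> Out \<union> C r"
    using edge by (auto simp: edge_T' verts_T')
  have lift_C: "\<exists>x\<in>C i. \<tau> i x = x'" if "i \<in> I" "x' \<in> C r" for i
    using \<tau>_bij[OF that(1)] that(2) by (metis bij_betw_imp_surj_on imageE)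
  show ?thesis
  using y
  proof (cases rule: verts_cases)
    case 1
    then have e: "x' \<rightarrow>\<^bsub>T\<^esub> y" using e by simp
    show ?thesis
    proof (cases "x' \<in> Out")
      case True
      then show ?thesis using e by (auto simp: Out_def)
    next
      case False
      then have "x' \<in> C r" using x' by simp
      moreover from this have "y = v" using closed[OF I(2) _ e] 1 Out_not_C I by blast
      moreover obtain x where "x \<in> C r" "\<tau> r x = x'" using lift_C I \<open>x' \<in> C r\<close> by blast
      ultimately show ?thesis
        using e \<tau>_root[OF I(2)] C[OF I(2)] I by (intro bexI[of _ x]) auto
    qed
  next
    case (2 i)
    then have e: "x' \<rightarrow>\<^bsub>T\<^esub> \<tau> i y" using e by simp
    show ?thesis
    proof (cases "x' = v")
      case True
      then show ?thesis using e 2 \<tau>_root v v_Out adj_sym by auto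
    next
      case False
      then have "x' \<in> C r" using closed[OF I(2) \<tau>_in] 2 e adj_sym by blast
      then obtain x where "x \<in> C i" "\<tau> i x = x'" using lift_C 2 by blast
      moreover from this have "x \<in> verts T" using C 2 by blast
      ultimately show ?thesis using e 2 \<tau>_edge by (intro bexI[of _ x]) auto
    qed
  qed
qed

text \<open>Each block contributes the weight of \<open>B' \<inter> C r\<close> once, which adds up to the factor in \<open>w'\<close>.\<close>

lemma sum_vimage_fold_map:
  assumes B': "B' \<subseteq> verts T'"
  shows "sum w {x \<in> verts T. fold_map x \<in> B'} = sum w' B'" (is "sum w ?B = _")
proof -
  have "sum w (?B \<inter> C i) = sum w (B' \<inter> C r)" if i: "i \<in> I" for i
  proof -
    have "\<tau> i ` (?B \<inter> C i) = B' \<inter> C r"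
    proof
      show "\<tau> i ` (?B \<inter> C i) \<subseteq> B' \<inter> C r" using i \<tau>_in[OF i] by auto
      show "B' \<inter> C r \<subseteq> \<tau> i ` (?B \<inter> C i)"
      proof
        fix y assume y: "y \<in> B' \<inter> C r"
        then obtain x where "x \<in> C i" "y = \<tau> i x"
          using \<tau>_bij[OF i] by (auto simp: bij_betw_def)
        then show "y \<in> \<tau> i ` (?B \<inter> C i)" using y i C[OF i] by auto
      qed
    qed
    moreover have "inj_on (\<tau> i) (?B \<inter> C i)"
      using \<tau>_bij[OF i] by (auto simp: bij_betw_def inj_on_def)
    ultimately have "bij_betw (\<tau> i) (?B \<inter> C i) (B' \<inter> C r)" by (simp add: bij_betw_def)
    then have "(\<Sum>x\<in>?B \<inter> C i. w (\<tau> i x)) = sum w (B' \<inter> C r)"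
      by (rule sum.reindex_bij_betw)
    moreover have "(\<Sum>x\<in>?B \<inter> C i. w (\<tau> i x)) = sum w (?B \<inter> C i)"
      using \<tau>_w[OF i] by (intro sum.cong) auto
    ultimately show ?thesis by simp
  qed
  moreover have "?B \<inter> Out = B' \<inter> Out" by (auto simp: Out_def)
  ultimately show ?thesis
    using sum_blocks[of ?B] sum_T'[OF B'] by simp
qed

lemma th_f_le_concentrated: "th_f T w \<le> th_f T' w'"
proof (rule th_f_mono)
  fix B' assume B': "B' \<subseteq> verts T'"
  let ?B = "{x \<in> verts T. fold_map x \<in> B'}"
  have "blue_after T ?B k = verts T" if k: "blue_after T' B' k = verts T'" for k
  proof
    show "blue_after T ?B k \<subseteq> verts T" by (rule blue_after_subset_verts) auto
    show "verts T \<subseteq> blue_after T ?B k"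
    proof
      fix y assume y: "y \<in> verts T"
      then have "fold_map y \<in> blue_after T' B' k" using fold_map_verts k by simp
      then show "y \<in> blue_after T ?B k"
        using blue_after_vimage[where G = T and H = T' and f = fold_map, OF fold_map_lift y]
        by blast
    qed
  qed
  then show "\<exists>B\<subseteq>verts T. sum w B \<le> sum w' B' \<and>
      (\<forall>k. blue_after T' B' k = verts T' \<longrightarrow> blue_after T B k = verts T)"
    using sum_vimage_fold_map[OF B'] by (intro exI[of _ ?B]) auto
qed (use finite_verts_T' in auto)

subsection \<open>Copying one block\<close>

definition collapse :: "'i \<Rightarrow> 'a \<Rightarrow> 'a" where
  "collapse i x = (if x \<in> C i then \<tau> i x else if x \<in> Out then x else v)"

context
  fixes i assumes i: "i \<in> I"
begin

lemma collapse_simps [simp]: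
  "x \<in> C i \<Longrightarrow> collapse i x = \<tau> i x"
  "x \<in> Out \<Longrightarrow> collapse i x = x"
  "j \<in> I \<Longrightarrow> j \<noteq> i \<Longrightarrow> x \<in> C j \<Longrightarrow> collapse i x = v"
  using Out_not_C C_unique i by (auto simp: collapse_def)

lemma collapse_eq_v:
  assumes "x \<in> verts T" "collapse i x = v"
  shows "x = v \<or> (\<exists>j\<in>I. j \<noteq> i \<and> x \<in> C j)"
  using assms(1)
proof (cases rule: verts_cases)
  case 1
  then show ?thesis using assms by simp
next
  case (2 j)
  then show ?thesis using assms \<tau>_in[OF i] v_not_C I by (cases "j = i") auto
qed

lemma collapse_verts: "x \<in> verts T \<Longrightarrow> collapse i x \<in> verts T'"
  using \<tau>_in i v_Out by (auto simp: collapse_def verts_T')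

lemma collapse_edge:
  assumes e: "x \<rightarrow>\<^bsub>T\<^esub> y"
  shows "collapse i x = collapse i y \<or> collapse i x \<rightarrow>\<^bsub>T'\<^esub> collapse i y"
proof -
  have xy: "x \<in> verts T" "y \<in> verts T" using e by auto
  have "collapse i x = collapse i y \<or> collapse i x \<rightarrow>\<^bsub>T\<^esub> collapse i y"
    if e: "x \<rightarrow>\<^bsub>T\<^esub> y" and j: "j \<in> I" "x \<in> C j" for x y j
  proof (cases "y = v")
    case True
    then show ?thesis using e j \<tau>_root v_Out by (cases "j = i") auto
  next
    case False
    then have "y \<in> C j" using closed e j by blast
    then show ?thesis using e j \<tau>_edge by (cases "j = i") auto
  qed note block = this
  have "collapse i x = collapse i y \<or> collapse i x \<rightarrow>\<^bsub>T\<^esub> collapse i y"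
  proof (cases "x \<in> Out \<and> y \<in> Out")
    case True
    then show ?thesis using e by simp
  next
    case False
    then obtain j where "j \<in> I" "x \<in> C j \<or> y \<in> C j"
      using xy by (auto simp: Out_def)
    then show ?thesis using block[of x y j] block[of y x j] e adj_sym by metis
  qed
  then show ?thesis using xy collapse_verts by (auto simp: edge_T')
qed

text \<open>A collapsed block has neighbors only in itself, where they are collapsed too, and in \<open>v\<close>.\<close>

lemma collapse_fibre:
  assumes e: "x \<rightarrow>\<^bsub>T\<^esub> y" and "collapse i x = v" "collapse i y \<noteq> v"
  shows "x = v"
proof (rule ccontr)
  assume "x \<noteq> v"
  then obtain j where j: "j \<in> I" "j \<noteq> i" "x \<in> C j"
    using assms collapse_eq_v[of x] adj_in_verts(1)[OF e] by blast
  then have "y = v \<or> y \<in> C j" using closed e by blast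
  then show False using assms j v_Out by auto
qed

lemma collapse_surj:
  assumes "z \<in> verts T'"
  shows "\<exists>x\<in>verts T. collapse i x = z"
proof (cases "z \<in> Out")
  case True
  then have "z \<in> verts T" by (simp add: Out_def)
  then show ?thesis using True by (intro bexI[of _ z]) auto
next
  case False
  then have "z \<in> \<tau> i ` C i"
    using assms \<tau>_bij[OF i] by (auto simp: verts_T' bij_betw_def)
  then show ?thesis using C[OF i] by (auto intro!: bexI)
qed

text \<open>
  The image of \<open>B\<close> under \<open>collapse i\<close>, except that \<open>v\<close> counts only if it belongs to \<open>B\<close> itself.
\<close>

definition copied :: "'a set \<Rightarrow> 'a set" where
  "copied B = (B \<inter> Out) \<union> \<tau> i ` (B \<inter> C i)"

lemma copied_subset: "copied B \<subseteq> verts T'"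
  using \<tau>_in[OF i] by (auto simp: copied_def verts_T')

lemma sum_copied:
  "sum w' (copied B) = sum w (B \<inter> Out) + real (card I) * sum w (B \<inter> C i)"
proof -
  have "inj_on (\<tau> i) (B \<inter> C i)"
    using \<tau>_bij[OF i] by (auto simp: bij_betw_def inj_on_def)
  then have "sum w (\<tau> i ` (B \<inter> C i)) = sum w (B \<inter> C i)"
    using \<tau>_w[OF i] by (subst sum.reindex) auto
  moreover have "copied B \<inter> Out = B \<inter> Out" "copied B \<inter> C r = \<tau> i ` (B \<inter> C i)"
    using \<tau>_in[OF i] Out_not_C I by (auto simp: copied_def)
  ultimately show ?thesis using sum_T'[OF copied_subset, of B] by simp
qed

lemma collapse_in_copied:
  assumes "x \<in> B" "collapse i x \<noteq> v"
  shows "collapse i x \<in> copied B"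
  using assms by (auto simp: collapse_def copied_def split: if_splits)

text \<open>With \<open>v\<close> blue from the start, all that the collapsed blocks could contribute is there already.\<close>

lemma blue_after_copied_insert:
  assumes "blue_after T B k = verts T"
  shows "blue_after T' (insert v (copied B)) k = verts T'"
proof
  show "blue_after T' (insert v (copied B)) k \<subseteq> verts T'"
    using v_Out copied_subset by (intro blue_after_subset_verts) (auto simp: verts_T')
  have B: "collapse i ` B \<subseteq> insert v (copied B)" using collapse_in_copied by blast
  have "collapse i x \<in> blue_after T' (insert v (copied B)) k" if "x \<in> verts T" for x
    by (rule blue_after_map[where G = T and B = B and f = "collapse i"])
       (use collapse_verts collapse_edge B assms that in auto)
  then show "verts T' \<subseteq> blue_after T' (insert v (copied B)) k"
    using collapse_surj by blast
qed

lemma blue_after_copied: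
  assumes "v \<notin> B"
    and forcer: "\<And>k. v \<notin> blue_after T B k \<Longrightarrow> v \<in> blue_after T B (Suc k) \<Longrightarrow>
                   \<exists>x\<in>blue_after T B k. x \<rightarrow>\<^bsub>T\<^esub> v \<and> collapse i x \<noteq> v"
    and k: "blue_after T B k = verts T"
  shows "blue_after T' (copied B) k = verts T'"
proof
  show "blue_after T' (copied B) k \<subseteq> verts T'"
    using copied_subset by (rule blue_after_subset_verts)
  have "collapse i x \<in> blue_after T' (copied B) k" if "x \<in> verts T" for x
    by (rule blue_after_collapse[of T "collapse i" T' v B "copied B" x k])
       (use collapse_verts collapse_edge collapse_fibre collapse_in_copied v_Out assms v that
         in auto)
  then show "verts T' \<subseteq> blue_after T' (copied B) k"
    using collapse_surj by blast
qed

end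

text \<open>
  Only the step in which \<open>v\<close> turns blue constrains \<open>i\<close>.  A forcing neighbor \<open>x\<close> of \<open>v\<close> in that step
  lies in one block, which is the one to keep, or in no block, and then any index will do.
\<close>

lemma first_forcer:
  assumes "B \<subseteq> verts T"
  obtains i where "i \<in> I"
    "\<And>k. v \<notin> blue_after T B k \<Longrightarrow> v \<in> blue_after T B (Suc k) \<Longrightarrow>
         \<exists>x\<in>blue_after T B k. x \<rightarrow>\<^bsub>T\<^esub> v \<and> collapse i x \<noteq> v"
proof (cases "\<exists>k. v \<notin> blue_after T B k \<and> v \<in> blue_after T B (Suc k)")
  case False
  then show ?thesis using that[OF I(2)] by blast
next
  case True
  then obtain k where k: "v \<notin> blue_after T B k" "v \<in> blue_after T B (Suc k)" by blast
  then obtain x where x: "x \<in> blue_after T B k" "x \<rightarrow>\<^bsub>T\<^esub> v"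
    by (auto simp: blue_after_Suc)
  have "x \<noteq> v" using k x by blast
  have "\<exists>i\<in>I. collapse i x \<noteq> v"
  proof (cases "x \<in> Out")
    case True
    then show ?thesis using I \<open>x \<noteq> v\<close> by auto
  next
    case False
    moreover have "x \<in> verts T" using x by auto
    ultimately obtain i where "i \<in> I" "x \<in> C i" by (auto simp: Out_def)
    then show ?thesis using \<tau>_in v_not_C I by (intro bexI[of _ i]) auto
  qed
  then obtain i where i: "i \<in> I" "collapse i x \<noteq> v" by blast
  \<comment> \<open>Blue sets grow, so \<open>v\<close> turns blue only once.\<close>
  have "k' = k" if "v \<notin> blue_after T B k'" "v \<in> blue_after T B (Suc k')" for k'
    using k that blue_after_mono[of "Suc k" k' T B] blue_after_mono[of "Suc k'" k T B]
    by (meson in_mono not_less_eq_eq le_antisym)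
  then show ?thesis using that[OF i(1)] i(2) x by blast
qed

text \<open>
  The choice of the block that is copied: by least weight if a unit can be saved to pay for \<open>v\<close> or
  \<open>v\<close> is blue anyway, and by the earliest forcing of \<open>v\<close> if all blocks cost the same.
\<close>

lemma th_f_concentrated_le: "th_f T' w' \<le> th_f T w"
proof (rule th_f_mono)
  fix B assume B: "B \<subseteq> verts T"
  define m where "m j = sum w (B \<inter> C j)" for j
  have m_int: "m j \<in> \<int>" if "j \<in> I" for j
    unfolding m_def using B w_int by (intro Ints_sum) auto
  have sum_B: "sum w B = sum w (B \<inter> Out) + sum m I"
    unfolding m_def by (rule sum_blocks[OF B])
  show "\<exists>B'\<subseteq>verts T'. sum w' B' \<le> sum w B \<and>
      (\<forall>k. blue_after T B k = verts T \<longrightarrow> blue_after T' B' k = verts T')"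
  proof (cases "v \<in> B \<or> (\<exists>i\<in>I. \<exists>j\<in>I. m i \<noteq> m j)")
    case True
    obtain i where i: "i \<in> I" and min: "\<And>j. j \<in> I \<Longrightarrow> m i \<le> m j"
      using ex_min_if_finite[of "m ` I"] I by (force simp: not_less)
    let ?B' = "insert v (copied i B)"
    have card_le: "real (card I) * m i \<le> sum m I"
      using sum_bounded_below[of I "m i" m] min by simp
    have "sum w' ?B' \<le> sum w B"
    proof (cases "v \<in> B")
      case True
      then have "v \<in> copied i B" using i v_Out by (simp add: copied_def)
      then show ?thesis using sum_copied[OF i, of B] sum_B card_le
        by (simp add: insert_absorb m_def)
    next
      case False
      then obtain j where j: "j \<in> I" "m j \<noteq> m i"
        using True by metis
      \<comment> \<open>Integral weights that differ do so by at least the weight of \<open>v\<close>.\<close>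
      have "m j \<ge> m i + 1"
      proof -
        obtain a b where "m j = of_int a" "m i = of_int b"
          using m_int i j by (meson Ints_cases)
        then show ?thesis using j min[of j] by auto
      qed
      then have "real (card I) * m i + 1 \<le> sum m I"
      proof -
        have "real (card I) * m i = m i + real (card (I - {j})) * m i"
          using card.remove[OF I(1) j(1)] by (simp add: algebra_simps)
        moreover have "real (card (I - {j})) * m i \<le> sum m (I - {j})"
          using sum_bounded_below[of "I - {j}" "m i" m] min by simp
        moreover have "sum m I = m j + sum m (I - {j})" using sum.remove[OF I(1) j(1)] .
        ultimately show ?thesis using \<open>m j \<ge> m i + 1\<close> by linarith
      qed
      moreover have "sum w' ?B' \<le> 1 + sum w' (copied i B)"
      proof -
        have "w' v = 1" using w' v v_Out v_not_C I by (simp add: verts_T')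
        moreover have "finite (copied i B)"
          using copied_subset[OF i] finite_verts_T' finite_subset by blast
        ultimately show ?thesis by (simp add: sum.insert_if)
      qed
      ultimately show ?thesis using sum_copied[OF i, of B] sum_B by (simp add: m_def)
    qed
    moreover have "?B' \<subseteq> verts T'"
      using copied_subset[OF i] v_Out by (auto simp: verts_T')
    ultimately show ?thesis
      using blue_after_copied_insert[OF i] by blast
  next
    case False
    obtain i where i: "i \<in> I" and
      forcer: "\<And>k. v \<notin> blue_after T B k \<Longrightarrow> v \<in> blue_after T B (Suc k) \<Longrightarrow>
         \<exists>x\<in>blue_after T B k. x \<rightarrow>\<^bsub>T\<^esub> v \<and> collapse i x \<noteq> v"
      using first_forcer[OF B] by blast
    have "m j = m i" if "j \<in> I" for j using False i that by blast
    then have "sum m I = (\<Sum>j\<in>I. m i)" by (rule sum.cong[OF refl])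
    then have "sum w' (copied i B) = sum w B"
      using sum_copied[OF i, of B] sum_B by (simp add: m_def)
    then show ?thesis
      using blue_after_copied[OF i] False forcer copied_subset[OF i] by (metis order_refl)
  qed
qed (use finite_verts_T' in auto)

lemma th_f_concentrated: "th_f T w = th_f T' w'"
  using th_f_le_concentrated th_f_concentrated_le by (rule antisym)

end

section \<open>Branches as blocks\<close>

lemma branch_verts:
  assumes "graph T" "H \<in> branches T v"
  shows "verts H \<in> pre_digraph.sccs_verts (pre_digraph.del_vert T v)"
proof -
  interpret graph T by fact
  interpret D: wf_digraph "del_vert v" by (rule wf_digraph_del_vert)
  show ?thesis using assms(2) by (auto simp: branches_def D.sccs_verts_conv)
qed

lemma branch_subset:
  assumes "graph T" "H \<in> branches T v"
  shows "verts H \<subseteq> verts T - {v}"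
proof -
  interpret graph T by fact
  interpret D: wf_digraph "del_vert v" by (rule wf_digraph_del_vert)
  show ?thesis using D.sccs_verts_subsets[OF branch_verts[OF assms]] by (simp add: del_vert_simps)
qed

lemma branches_disjoint:
  assumes "graph T" "H \<in> branches T v" "K \<in> branches T v" "H \<noteq> K"
  shows "verts H \<inter> verts K = {}"
proof -
  interpret graph T by fact
  interpret D: wf_digraph "del_vert v" by (rule wf_digraph_del_vert)
  show ?thesis using D.scc_disj assms by (simp add: branches_def)
qed

lemma finite_branches:
  assumes "graph T"
  shows "finite (branches T v)"
proof -
  interpret graph T by fact
  interpret D: fin_digraph "del_vert v" by (rule fin_digraph_del_vert)
  show ?thesis
    unfolding branches_def D.sccs_conv_sccs_verts using D.finite_sccs_verts by simp
qed

text \<open>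
  Since \<open>T\<close> is symmetric, both ends of an edge that avoids \<open>v\<close> lie in the same strongly connected
  component of \<open>T - v\<close>.
\<close>

lemma branch_closed:
  assumes "graph T" "H \<in> branches T v"
    and x: "x \<in> verts H" and e: "x \<rightarrow>\<^bsub>T\<^esub> y" and y: "y \<noteq> v"
  shows "y \<in> verts H"
proof -
  interpret graph T by fact
  interpret D: wf_digraph "del_vert v" by (rule wf_digraph_del_vert)
  have "x \<noteq> v" using branch_subset[OF assms(1,2)] x by blast
  have "y \<rightarrow>\<^bsub>T\<^esub> x" using e sym_arcs by (metis symmetric_def symD)
  have "x \<rightarrow>\<^bsub>del_vert v\<^esub> y" "y \<rightarrow>\<^bsub>del_vert v\<^esub> x"
    using e \<open>y \<rightarrow>\<^bsub>T\<^esub> x\<close> \<open>x \<noteq> v\<close> y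
    by (auto simp: arcs_ends_def arc_to_ends_def del_vert_simps)
  then have "x \<rightarrow>\<^sup>*\<^bsub>del_vert v\<^esub> y" "y \<rightarrow>\<^sup>*\<^bsub>del_vert v\<^esub> x" by auto
  then show ?thesis
    using branch_verts[OF assms(1,2)] x D.in_sccs_verts_conv_reachable by blast
qed

text \<open>
  The automorphism behind a weight isomorphism of \<open>H\<close> and \<open>T1\<close> fixes \<open>v\<close>, which lies in no branch
  at \<open>v\<close>; its restriction to \<open>H\<close> is the map that the locale asks for.
\<close>

lemma single_concentration_th_f:
  assumes "single_concentration (T, w) (T', w')"
  shows "th_f T w = th_f T' w'"
  using assms
proof cases
  case (1 v S T1)
  have graph: "graph T" and w: "\<And>x. x \<in> verts T \<Longrightarrow> 0 < w x \<and> w x \<in> \<int>"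
    using 1 by (auto simp: integer_weighted_tree_def weighted_tree_def simple_tree_def)
  interpret graph T by (rule graph)
  have S: "S \<subseteq> branches T v" and iso: "pairwise (weight_isomorphic T w) S"
    using 1 by (auto simp: maximal_weight_isomorphic_branches_def weight_isomorphic_branches_def)
  have sub: "verts H \<subseteq> verts T - {v}" if "H \<in> S" for H
    using branch_subset[OF graph] S that by blast
  have "\<exists>\<sigma>. bij_betw \<sigma> (verts H) (verts T1) \<and>
      (\<forall>x\<in>verts H. \<forall>y\<in>verts H. \<sigma> x \<rightarrow>\<^bsub>T\<^esub> \<sigma> y \<longleftrightarrow> x \<rightarrow>\<^bsub>T\<^esub> y) \<and>
      (\<forall>x\<in>verts H. (\<sigma> x \<rightarrow>\<^bsub>T\<^esub> v \<longleftrightarrow> x \<rightarrow>\<^bsub>T\<^esub> v) \<and> w (\<sigma> x) = w x)" if H: "H \<in> S" for H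
  proof (cases "H = T1")
    case True
    then show ?thesis by (intro exI[of _ id]) auto
  next
    case False
    then have "weight_isomorphic T w H T1" using iso H \<open>T1 \<in> S\<close> by (auto simp: pairwise_def)
    then obtain \<sigma> where \<sigma>: "graph_automorphism T \<sigma>"
        "\<forall>x\<in>verts T - (verts H \<union> verts T1). \<sigma> x = x"
        "\<sigma> ` verts H = verts T1" "\<forall>x\<in>verts H. w x = w (\<sigma> x)"
      unfolding weight_isomorphic_def by blast
    have edge: "\<sigma> x \<rightarrow>\<^bsub>T\<^esub> \<sigma> y \<longleftrightarrow> x \<rightarrow>\<^bsub>T\<^esub> y" if "x \<in> verts T" "y \<in> verts T" for x y
      using \<sigma>(1) that by (auto simp: graph_automorphism_def)
    have "\<sigma> v = v" using \<sigma>(2) sub[OF H] sub[OF \<open>T1 \<in> S\<close>] \<open>v \<in> verts T\<close> by blast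
    moreover have "inj_on \<sigma> (verts H)"
      using \<sigma>(1) sub[OF H] by (auto simp: graph_automorphism_def bij_betw_def intro: inj_on_subset)
    ultimately show ?thesis
      using \<sigma> edge edge[of _ v] sub[OF H] \<open>v \<in> verts T\<close>
      by (intro exI[of _ \<sigma>]) (auto simp: bij_betw_def subset_iff)
  qed
  then obtain \<tau> where \<tau>: "\<And>H. H \<in> S \<Longrightarrow> bij_betw (\<tau> H) (verts H) (verts T1) \<and>
      (\<forall>x\<in>verts H. \<forall>y\<in>verts H. \<tau> H x \<rightarrow>\<^bsub>T\<^esub> \<tau> H y \<longleftrightarrow> x \<rightarrow>\<^bsub>T\<^esub> y) \<and>
      (\<forall>x\<in>verts H. (\<tau> H x \<rightarrow>\<^bsub>T\<^esub> v \<longleftrightarrow> x \<rightarrow>\<^bsub>T\<^esub> v) \<and> w (\<tau> H x) = w x)"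
    by metis
  interpret isomorphic_blocks T w v S verts T1 \<tau> T' w'
  proof
    show "finite S" using finite_branches[OF graph] S finite_subset by blast
    show "\<And>i j. i \<in> S \<Longrightarrow> j \<in> S \<Longrightarrow> i \<noteq> j \<Longrightarrow> verts i \<inter> verts j = {}"
      using branches_disjoint[OF graph] S by blast
    show "\<And>i x y. i \<in> S \<Longrightarrow> x \<in> verts i \<Longrightarrow> x \<rightarrow>\<^bsub>T\<^esub> y \<Longrightarrow> y \<noteq> v \<Longrightarrow> y \<in> verts i"
      using branch_closed[OF graph] S by blast
    show "\<And>i. i \<in> S \<Longrightarrow> verts i \<subseteq> verts T - {v}" by (rule sub)
    show "\<And>i. i \<in> S \<Longrightarrow> bij_betw (\<tau> i) (verts i) (verts T1)"
      "\<And>i x y. i \<in> S \<Longrightarrow> x \<in> verts i \<Longrightarrow> y \<in> verts i \<Longrightarrow> \<tau> i x \<rightarrow>\<^bsub>T\<^esub> \<tau> i y \<longleftrightarrow> x \<rightarrow>\<^bsub>T\<^esub> y"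
      "\<And>i x. i \<in> S \<Longrightarrow> x \<in> verts i \<Longrightarrow> \<tau> i x \<rightarrow>\<^bsub>T\<^esub> v \<longleftrightarrow> x \<rightarrow>\<^bsub>T\<^esub> v"
      "\<And>i x. i \<in> S \<Longrightarrow> x \<in> verts i \<Longrightarrow> w (\<tau> i x) = w x"
      using \<tau> by blast+
    show "\<And>x. x \<in> verts T \<Longrightarrow> w x \<in> \<int>" using w by blast
    show "\<And>x. x \<in> verts T' \<Longrightarrow> w' x = (if x \<in> verts T1 then real (card S) * w x else w x)"
      using 1 by blast
  qed (fact 1)+
  show ?thesis by (rule th_f_concentrated)
qed

theorem theorem2p10:
  fixes T T' :: "('a, 'b) pre_digraph" and w w' :: "'a \<Rightarrow> real"
  assumes "integer_weighted_tree T w"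
    and "concentration (T, w) (T', w')"
  shows "th_f T w = th_f T' w'"
proof -
  have "th_f (fst p) (snd p) = th_f (fst q) (snd q)"
    if "concentration p q" for p q :: "('a, 'b) pre_digraph \<times> ('a \<Rightarrow> real)"
    using that unfolding concentration_def
  proof (induction rule: tranclp_induct)
    case (base q)
    then show ?case using single_concentration_th_f by (cases p; cases q) auto
  next
    case (step q s)
    then show ?case using single_concentration_th_f by (cases q; cases s) auto
  qed
  from this[OF assms(2)] show ?thesis by simp
qed

end
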